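(* For every $n\ge 1$, the complete graph $K_n$ is a minimal element in the poset $\mathcal{S}_n$.
   Context: All graphs are finite and simple. The chromatic symmetric function of a graph $G$ with vertices $v_1,\dots,v_n$ is $X_G=\sum_{\kappa}x_{\kappa(v_1)}\cdots x_{\kappa(v_n)}$, summed over all proper colorings $\kappa:V(G)\to\{1,2,3,\dots\}$; it is a homogeneous symmetric function of degree $n$ over $\mathbb{Q}$. Let $s_\lambda$ be the Schur symmetric functions; $[s_\lambda]F$ denotes the coefficient of $s_\lambda$ in $F$ expanded in this basis, and $F$ is Schur-positive if $[s_\lambda]F\ge 0$ for all $\lambda$. For connected graphs $G,H$ on $n$ vertices (for which $[s_{(1^n)}]X_G$ and $[s_{(1^n)}]X_H$ are positive), set $$X_s(G,H)=X_G-\frac{[s_{(1^n)}]X_G}{[s_{(1^n)}]X_H}X_H.$$ $\mathcal{S}_n$ is the poset whose elements are the equivalence classes of connected graphs on $n$ vertices under $G\sim H\iff X_G=X_H$, ordered by $G\geq_s H$ if and only if $X_s(G,H)$ is Schur-positive. An element $x$ of a poset is minimal if $y\geq x$ for every $y$ comparable to $x$. *)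

theory Defs
  imports "Graph_Theory.Kuratowski" "HOL-Library.Function_Algebras" "HOL-Library.FuncSet"
    "HOL-Library.Multiset" HOL.Rat
begin

text \<open>
  Formal power series over \<open>\<rat>\<close> in the variables \<open>x\<^sub>1, x\<^sub>2, \<dots>\<close> are represented by their coefficient
  functions. A monomial \<open>x\<^bsub>i\<^sub>1\<^esub> \<cdots> x\<^bsub>i\<^sub>k\<^esub>\<close> is the multiset of its indices. Addition and subtraction are
  pointwise (\<open>Function_Algebras\<close>); the pointwise product of that theory is not the product of
  power series and is not used.
\<close>

type_synonym pseries = "nat multiset \<Rightarrow> rat"

definition pscale :: "rat \<Rightarrow> pseries \<Rightarrow> pseries" where
  "pscale c F = (\<lambda>m. c * F m)"

global_interpretation pseries: vector_space pscale
  by unfold_locales (auto simp: pscale_def fun_eq_iff algebra_simps)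

text \<open>
  Graphs are symmetric loop-free digraphs without parallel arcs (\<^const>\<open>pair_graph\<close>): the edge
  \<open>uv\<close> is the pair of arcs \<open>(u, v)\<close>, \<open>(v, u)\<close>.
\<close>

definition proper_colorings :: "'a pair_pre_digraph \<Rightarrow> ('a \<Rightarrow> nat) set" where
  "proper_colorings G =
     {\<kappa> \<in> pverts G \<rightarrow>\<^sub>E {1..}. \<forall>(u, v) \<in> parcs G. \<kappa> u \<noteq> \<kappa> v}"

text \<open>
  The coefficient of a monomial in the chromatic symmetric function is the number of proper
  colorings producing it. Only colors occurring in the monomial can be used, so for finite
  \<open>G\<close> the set counted here is finite; the same holds for the tableaux below.
\<close>

definition chromatic_sym :: "'a pair_pre_digraph \<Rightarrow> pseries" where
  "chromatic_sym G =
     (\<lambda>m. of_nat (card {\<kappa> \<in> proper_colorings G. image_mset \<kappa> (mset_set (pverts G)) = m}))"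

definition partition :: "nat list \<Rightarrow> bool" where
  "partition lam \<longleftrightarrow> sorted_wrt (\<ge>) lam \<and> 0 \<notin> set lam"

text \<open>Cells \<open>(row, column)\<close> of the Young diagram, both counted from 0.\<close>

definition cells :: "nat list \<Rightarrow> (nat \<times> nat) set" where
  "cells lam = (SIGMA i:{..<length lam}. {..<lam ! i})"

definition ssyt :: "nat list \<Rightarrow> (nat \<times> nat \<Rightarrow> nat) set" where
  "ssyt lam = {T \<in> cells lam \<rightarrow>\<^sub>E {1..}.
     (\<forall>i j. (i, Suc j) \<in> cells lam \<longrightarrow> T (i, j) \<le> T (i, Suc j)) \<and>
     (\<forall>i j. (Suc i, j) \<in> cells lam \<longrightarrow> T (i, j) < T (Suc i, j))}"

definition schur :: "nat list \<Rightarrow> pseries" where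
  "schur lam = (\<lambda>m. of_nat (card {T \<in> ssyt lam. image_mset T (mset_set (cells lam)) = m}))"

text \<open>
  \<open>[s\<^sub>\<lambda>]F\<close>, for \<open>F\<close> in the span of the Schur functions, which is the space of symmetric functions.
\<close>

definition schur_coeff :: "nat list \<Rightarrow> pseries \<Rightarrow> rat" where
  "schur_coeff lam F = pseries.representation (schur ` {mu. partition mu}) F (schur lam)"

definition schur_positive :: "pseries \<Rightarrow> bool" where
  "schur_positive F \<longleftrightarrow> (\<forall>lam. partition lam \<longrightarrow> schur_coeff lam F \<ge> 0)"

text \<open>\<open>X\<^sub>s(G, H)\<close> for graphs on \<open>n\<close> vertices; \<open>replicate n 1\<close> is the partition \<open>(1\<^sup>n)\<close>.\<close>

definition X_s :: "nat \<Rightarrow> 'a pair_pre_digraph \<Rightarrow> 'a pair_pre_digraph \<Rightarrow> pseries" where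
  "X_s n G H = chromatic_sym G -
     pscale (schur_coeff (replicate n 1) (chromatic_sym G) /
             schur_coeff (replicate n 1) (chromatic_sym H)) (chromatic_sym H)"

definition conn_graphs :: "nat \<Rightarrow> 'a pair_pre_digraph set" where
  "conn_graphs n = {G. pair_graph G \<and> connected (with_proj G) \<and> card (pverts G) = n}"

definition same_csf :: "nat \<Rightarrow> ('a pair_pre_digraph \<times> 'a pair_pre_digraph) set" where
  "same_csf n = {(G, H) \<in> conn_graphs n \<times> conn_graphs n. chromatic_sym G = chromatic_sym H}"

text \<open>
  The poset \<open>S\<^sub>n\<close>, for graphs with vertices in the type \<^typ>\<open>'a\<close>. Since the chromatic symmetric
  function is invariant under isomorphism, it does not depend on \<^typ>\<open>'a\<close> up to isomorphism of
  posets, provided that \<^typ>\<open>'a\<close> has at least \<open>n\<close> elements.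
\<close>

definition S_poset :: "nat \<Rightarrow> 'a pair_pre_digraph set set" where
  "S_poset n = conn_graphs n // same_csf n"

text \<open>\<open>X_s n G H\<close> depends only on the classes of \<open>G\<close> and \<open>H\<close>, so any representatives will do.\<close>

definition ge_s :: "nat \<Rightarrow> 'a pair_pre_digraph set \<Rightarrow> 'a pair_pre_digraph set \<Rightarrow> bool" where
  "ge_s n A B \<longleftrightarrow> (\<exists>G\<in>A. \<exists>H\<in>B. schur_positive (X_s n G H))"

definition minimal_elem :: "'b set \<Rightarrow> ('b \<Rightarrow> 'b \<Rightarrow> bool) \<Rightarrow> 'b \<Rightarrow> bool" where
  "minimal_elem P ge x \<longleftrightarrow> x \<in> P \<and> (\<forall>y\<in>P. ge x y \<or> ge y x \<longrightarrow> ge y x)"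

end

theory Submission
  imports Defs
begin

text \<open>
  Write \<open>X\<^sub>G = c s\<^bsub>(1\<^sup>n)\<^esub> + \<Sum> a\<^sub>\<lambda> s\<^sub>\<lambda>\<close>, the sum being over \<open>\<lambda> \<noteq> (1\<^sup>n)\<close>, and recall that \<open>X\<close> of \<open>K\<^sub>n\<close> is a
  positive multiple of \<open>s\<^bsub>(1\<^sup>n)\<^esub>\<close>. Then \<open>G \<ge> K\<^sub>n\<close> says that all \<open>a\<^sub>\<lambda>\<close> are nonnegative, and \<open>K\<^sub>n \<ge> G\<close> that all
  \<open>-a\<^sub>\<lambda> / c\<close> are. If \<open>c > 0\<close> and some \<open>a\<^sub>\<lambda>\<close> were negative in the second case, the coefficient of \<open>x\<^sup>\<lambda>\<close> in
  \<open>X\<^sub>G\<close> would be negative, since \<open>s\<^bsub>(1\<^sup>n)\<^esub>\<close> does not contain \<open>x\<^sup>\<lambda>\<close>, whereas \<open>s\<^sub>\<lambda>\<close> does. If \<open>c < 0\<close>, there is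
  nothing to do.

  To see that \<open>c \<noteq> 0\<close>, pair with \<open>e\<^sub>n = \<Sum> (-1)\<^bsup>n - l(\<alpha>)\<^esup> h\<^sub>\<alpha>\<close>, the sum being over the compositions of \<open>n\<close>:
  this is an alternating sum of coefficients of the monomials \<open>x\<^sup>\<alpha>\<close>, that is, a signed count of the
  colorings or tableaux whose set of values is an initial segment of the positive integers. A
  sign-reversing involution shows that it vanishes on \<open>s\<^sub>\<lambda>\<close> for \<open>\<lambda> \<noteq> (1\<^sup>n)\<close> and that on \<open>X\<^sub>G\<close> it is, up to
  sign, the number of acyclic orientations of \<open>G\<close>.
\<close>

section \<open>Packed maps and the sign-reversing involution\<close>

text \<open>\<open>S\<close> holds the strict constraints and \<open>W\<close> the weak ones.\<close>

definition packed_maps ::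
  "'v set \<Rightarrow> ('v \<times> 'v) set \<Rightarrow> ('v \<times> 'v) set \<Rightarrow> ('v \<Rightarrow> nat) set" where
  "packed_maps V S W = {f \<in> extensional V. (\<exists>l. f ` V = {1..l}) \<and>
     (\<forall>u\<in>V. \<forall>v\<in>V. ((u, v) \<in> S \<longrightarrow> f u < f v) \<and> ((u, v) \<in> W \<longrightarrow> f u \<le> f v))}"

definition alternating_sum :: "'v set \<Rightarrow> ('v \<Rightarrow> nat) set \<Rightarrow> rat" where
  "alternating_sum V F = (\<Sum>f\<in>F. (- 1) ^ card (f ` V))"

lemma packed_mapsE:
  assumes "f \<in> packed_maps V S W"
  obtains l where "f \<in> extensional V" "f ` V = {1..l}"
    "\<And>u v. u \<in> V \<Longrightarrow> v \<in> V \<Longrightarrow> (u, v) \<in> S \<Longrightarrow> f u < f v"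
    "\<And>u v. u \<in> V \<Longrightarrow> v \<in> V \<Longrightarrow> (u, v) \<in> W \<Longrightarrow> f u \<le> f v"
  using assms unfolding packed_maps_def by blast

lemma packed_image_subset:
  assumes "finite V" and "f ` V = {1..l}"
  shows "f ` V \<subseteq> {1..card V}"
proof -
  have "l \<le> card V"
    using card_image_le[OF assms(1), of f] assms(2) by simp
  then show ?thesis using assms(2) by auto
qed

lemma finite_packed_maps:
  assumes "finite V"
  shows "finite (packed_maps V S W)"
proof (rule finite_subset)
  show "packed_maps V S W \<subseteq> V \<rightarrow>\<^sub>E {1..card V}"
  proof
    fix f assume "f \<in> packed_maps V S W"
    then obtain l where f: "f \<in> extensional V" "f ` V = {1..l}" by (rule packed_mapsE)
    have "f ` V \<subseteq> {1..card V}" using assms f(2) by (rule packed_image_subset)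
    then show "f \<in> V \<rightarrow>\<^sub>E {1..card V}" using f(1) by (auto simp: PiE_def)
  qed
  show "finite (V \<rightarrow>\<^sub>E {1..card V})"
    using assms by (rule finite_PiE) simp
qed

definition split_off :: "'v set \<Rightarrow> 'v \<Rightarrow> ('v \<Rightarrow> nat) \<Rightarrow> 'v \<Rightarrow> nat" where
  "split_off V c f = (\<lambda>v\<in>V. if v = c \<or> f c < f v then f v + 1 else f v)"

definition merge_down :: "'v set \<Rightarrow> 'v \<Rightarrow> ('v \<Rightarrow> nat) \<Rightarrow> 'v \<Rightarrow> nat" where
  "merge_down V c f = (\<lambda>v\<in>V. if f c \<le> f v then f v - 1 else f v)"

text \<open>Another element stays on the level \<open>f c\<close>, so lifting \<open>c\<close> off
  it leaves no gap; \<open>c\<close> itself fills the level that opens when everything above moves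
  up by one.\<close>

lemma split_off_image:
  assumes "c \<in> V" "f ` V = {1..l}" "\<exists>v\<in>V - {c}. f v = f c"
  shows "split_off V c f ` V = {1..Suc l}"
proof
  have "f v \<in> {1..l}" if "v \<in> V" for v using that assms(2) by blast
  then show "split_off V c f ` V \<subseteq> {1..Suc l}"
    by (force simp: split_off_def)
  show "{1..Suc l} \<subseteq> split_off V c f ` V"
  proof
    fix y assume y: "y \<in> {1..Suc l}"
    have fc: "f c \<in> {1..l}" using assms(1,2) by blast
    consider "y \<le> f c" | "y = Suc (f c)" | "Suc (f c) < y" by linarith
    then show "y \<in> split_off V c f ` V"
    proof cases
      case 1
      then have "y \<in> f ` V" using y fc assms(2) by auto
      then obtain v where "v \<in> V" "f v = y" "v \<noteq> c"
        using assms(1,3) by (cases "y = f c") auto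
      then have "split_off V c f v = y" using 1 by (auto simp: split_off_def)
      then show ?thesis using \<open>v \<in> V\<close> by blast
    next
      case 2
      then have "split_off V c f c = y" using assms(1) by (simp add: split_off_def)
      then show ?thesis using assms(1) by blast
    next
      case 3
      then have "y - 1 \<in> f ` V" using y assms(2) by auto
      then obtain v where "v \<in> V" "f v = y - 1" by auto
      then have "split_off V c f v = y" using 3 by (auto simp: split_off_def)
      then show ?thesis using \<open>v \<in> V\<close> by blast
    qed
  qed
qed

text \<open>Some element lies below \<open>c\<close>, so \<open>f c\<close> is at least 2, and
  shifting it and everything higher down by one never reaches 0.\<close>

lemma merge_down_image:
  assumes "c \<in> V" "f ` V = {1..l}" "\<forall>v\<in>V - {c}. f v \<noteq> f c" "\<exists>v\<in>V. f v < f c"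
  shows "merge_down V c f ` V = {1..l - 1}"
proof
  obtain w where w: "w \<in> V" "f w < f c" using assms(4) by blast
  have rng: "f v \<in> {1..l}" if "v \<in> V" for v using that assms(2) by blast
  have fc: "2 \<le> f c" "f c \<le> l" using w rng[of w] rng[of c] assms(1) by auto
  show "merge_down V c f ` V \<subseteq> {1..l - 1}"
    using rng fc by (force simp: merge_down_def)
  show "{1..l - 1} \<subseteq> merge_down V c f ` V"
  proof
    fix y assume y: "y \<in> {1..l - 1}"
    show "y \<in> merge_down V c f ` V"
    proof (cases "y < f c")
      case True
      then have "y \<in> f ` V" using y assms(2) by auto
      then obtain v where "v \<in> V" "f v = y" by auto
      then have "merge_down V c f v = y" using True by (auto simp: merge_down_def)
      then show ?thesis using \<open>v \<in> V\<close> by blast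
    next
      case False
      then have "y + 1 \<in> f ` V" using y assms(2) by auto
      then obtain v where "v \<in> V" "f v = y + 1" by auto
      then have "merge_down V c f v = y" using False by (auto simp: merge_down_def)
      then show ?thesis using \<open>v \<in> V\<close> by blast
    qed
  qed
qed

text \<open>
  \<^const>\<open>split_off\<close> moves \<open>c\<close> to a new level just above its old one, \<^const>\<open>merge_down\<close> joins a lone \<open>c\<close>
  to the level below. They are inverse to each other and reverse the sign; what remains are the
  maps for which \<open>c\<close> is alone on the lowest level.
\<close>

lemma alternating_sum_bottom:
  assumes "finite V" "c \<in> V"
    and W: "\<And>v. v \<in> V \<Longrightarrow> (c, v) \<notin> W" and S: "\<And>u. u \<in> V \<Longrightarrow> (u, c) \<notin> S"
  shows "alternating_sum V (packed_maps V S W) =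
    alternating_sum V {f \<in> packed_maps V S W. \<forall>v\<in>V - {c}. f c < f v}"
proof -
  define P where "P = packed_maps V S W"
  define N where "N = {f \<in> P. \<exists>v\<in>V - {c}. f v = f c}"
  define L where "L = {f \<in> P. (\<forall>v\<in>V - {c}. f v \<noteq> f c) \<and> (\<exists>v\<in>V. f v < f c)}"
  define Q where "Q = {f \<in> P. \<forall>v\<in>V - {c}. f c < f v}"
  have finP: "finite P" unfolding P_def using assms(1) by (rule finite_packed_maps)
  have N_split: "split_off V c f \<in> L \<and> merge_down V c (split_off V c f) = f \<and>
      card (split_off V c f ` V) = Suc (card (f ` V))" if "f \<in> N" for f
  proof (intro conjI)
    from that have fP: "f \<in> packed_maps V S W" and f3: "\<exists>v\<in>V - {c}. f v = f c"
      by (auto simp: N_def P_def)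
    from fP obtain l where f: "f \<in> extensional V" "f ` V = {1..l}"
      "\<And>u v. u \<in> V \<Longrightarrow> v \<in> V \<Longrightarrow> (u, v) \<in> S \<Longrightarrow> f u < f v"
      "\<And>u v. u \<in> V \<Longrightarrow> v \<in> V \<Longrightarrow> (u, v) \<in> W \<Longrightarrow> f u \<le> f v"
      by (rule packed_mapsE) blast
    note im = split_off_image[OF assms(2) f(2) f3]
    show "card (split_off V c f ` V) = Suc (card (f ` V))"
      unfolding im f(2) by simp
    show "merge_down V c (split_off V c f) = f"
      using f(1) assms(2) by (auto simp: fun_eq_iff merge_down_def split_off_def extensional_def)
    have "split_off V c f u < split_off V c f v" if "u \<in> V" "v \<in> V" "(u, v) \<in> S" for u v
      using f(3)[OF that] S[of u] that by (auto simp: split_off_def)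
    \<comment> \<open>Raising \<open>c\<close> could only break a weak constraint from
      \<open>c\<close> to an element of its old level; the assumption \<open>W\<close> excludes
      constraints that start at \<open>c\<close>.\<close>
    moreover have "split_off V c f u \<le> split_off V c f v" if "u \<in> V" "v \<in> V" "(u, v) \<in> W" for u v
      using f(4)[OF that] W[of v] that by (auto simp: split_off_def)
    ultimately have "split_off V c f \<in> P"
      unfolding P_def packed_maps_def using im by (auto simp: split_off_def)
    moreover have "\<forall>v\<in>V - {c}. split_off V c f v \<noteq> split_off V c f c"
      using assms(2) by (auto simp: split_off_def)
    moreover have "\<exists>v\<in>V. split_off V c f v < split_off V c f c"
    proof -
      obtain v where "v \<in> V" "v \<noteq> c" "f v = f c" using f3 by blast
      then have "split_off V c f v < split_off V c f c"
        using assms(2) by (simp add: split_off_def)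
      then show ?thesis using \<open>v \<in> V\<close> by blast
    qed
    ultimately show "split_off V c f \<in> L" unfolding L_def by blast
  qed
  have L_merge: "merge_down V c f \<in> N \<and> split_off V c (merge_down V c f) = f" if "f \<in> L" for f
  proof
    from that have fP: "f \<in> packed_maps V S W" and alone: "\<forall>v\<in>V - {c}. f v \<noteq> f c"
      and low: "\<exists>v\<in>V. f v < f c"
      by (auto simp: L_def P_def)
    from fP obtain l where f: "f \<in> extensional V" "f ` V = {1..l}"
      "\<And>u v. u \<in> V \<Longrightarrow> v \<in> V \<Longrightarrow> (u, v) \<in> S \<Longrightarrow> f u < f v"
      "\<And>u v. u \<in> V \<Longrightarrow> v \<in> V \<Longrightarrow> (u, v) \<in> W \<Longrightarrow> f u \<le> f v"
      by (rule packed_mapsE) blast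
    note im = merge_down_image[OF assms(2) f(2) alone low]
    have pos: "0 < f c" using low by auto
    show "split_off V c (merge_down V c f) = f"
    proof
      fix v show "split_off V c (merge_down V c f) v = f v"
        using f(1) alone[rule_format, of v] assms(2) pos
        by (cases "v \<in> V"; cases "v = c") (auto simp: merge_down_def split_off_def extensional_def)
    qed
    \<comment> \<open>As \<open>c\<close> is alone, every other element that moves down was strictly
      above \<open>f c\<close>. Only a strict constraint ending in \<open>c\<close> could collapse,
      and the assumption \<open>S\<close> excludes those.\<close>
    have "merge_down V c f u < merge_down V c f v" if "u \<in> V" "v \<in> V" "(u, v) \<in> S" for u v
      using f(3)[OF that] S[of u] alone[rule_format, of v] pos that
      by (cases "v = c") (auto simp: merge_down_def)
    moreover have "merge_down V c f u \<le> merge_down V c f v"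
      if "u \<in> V" "v \<in> V" "(u, v) \<in> W" for u v
      using f(4)[OF that] alone[rule_format, of u] that W[of v] by (auto simp: merge_down_def)
    ultimately have "merge_down V c f \<in> P"
      unfolding P_def packed_maps_def using im by (auto simp: merge_down_def)
    \<comment> \<open>The levels of a packed map have no gaps, so there is an element just below
      \<open>c\<close> to join.\<close>
    moreover have "\<exists>v\<in>V - {c}. merge_down V c f v = merge_down V c f c"
    proof -
      obtain w where "w \<in> V" "f w < f c" using low by blast
      moreover have "f c \<in> {1..l}" using f(2) assms(2) by blast
      moreover have "f w \<in> {1..l}" using f(2) \<open>w \<in> V\<close> by blast
      ultimately have "f c - 1 \<in> f ` V" unfolding f(2) atLeastAtMost_iff by linarith
      then obtain v where "v \<in> V" "f v = f c - 1" by auto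
      then have "v \<in> V - {c}" "merge_down V c f v = merge_down V c f c"
        using pos assms(2) by (auto simp: merge_down_def)
      then show ?thesis by blast
    qed
    ultimately show "merge_down V c f \<in> N" unfolding N_def by blast
  qed
  have "(\<Sum>f\<in>N. (- 1 :: rat) ^ card (f ` V)) = (\<Sum>f\<in>L. - ((- 1) ^ card (f ` V)))"
    by (rule sum.reindex_bij_witness[of N "merge_down V c" "split_off V c"])
      (use N_split L_merge in auto)
  then have cancel: "alternating_sum V N + alternating_sum V L = 0"
    by (simp add: alternating_sum_def sum_negf)
  have "P = N \<union> L \<union> Q"
    unfolding N_def L_def Q_def by (force simp: neq_iff)
  moreover have "N \<inter> L = {}" unfolding N_def L_def by blast
  moreover have "(N \<union> L) \<inter> Q = {}"
  proof -
    have "\<not> f v < f c" if "f \<in> Q" "v \<in> V" for f v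
      using that by (cases "v = c") (auto simp: Q_def not_less less_imp_le)
    moreover have "f v \<noteq> f c" if "f \<in> Q" "v \<in> V - {c}" for f v
    proof -
      have "f c < f v" using that by (auto simp: Q_def)
      then show ?thesis by simp
    qed
    ultimately show ?thesis unfolding N_def L_def by blast
  qed
  moreover have "finite N" "finite L" "finite Q"
    using finP unfolding N_def L_def Q_def by auto
  ultimately have "alternating_sum V P = alternating_sum V N + alternating_sum V L + alternating_sum V Q"
    unfolding alternating_sum_def by (simp add: sum.union_disjoint)
  then show ?thesis using cancel unfolding P_def[symmetric] Q_def by simp
qed

text \<open>The relation \<open>S\<close> is acyclic because \<open>\<kappa>\<close> increases along
  it. An element \<open>c\<close> of \<open>V\<close> with least \<open>\<kappa>\<close> has no
  predecessor in \<open>V\<close>, so by \<open>alternating_sum_bottom\<close> only the maps with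
  \<open>c\<close> alone on level 1 remain. Deleting \<open>c\<close> removes that level, which
  gives a factor -1 at each step of the induction.\<close>

lemma alternating_sum_strict:
  fixes \<kappa> :: "'v \<Rightarrow> nat"
  assumes "finite V" and "\<And>u v. (u, v) \<in> S \<Longrightarrow> \<kappa> u < \<kappa> v"
  shows "alternating_sum V (packed_maps V S {}) = (- 1) ^ card V"
  using assms(1)
proof (induction "card V" arbitrary: V)
  case 0
  \<comment> \<open>Here \<open>V\<close> is empty: the image is \<open>{1..0}\<close>, and
    extensionality leaves a single map.\<close>
  then have "packed_maps V S {} = {\<lambda>_. undefined}"
    by (auto simp: packed_maps_def)
  then show ?case using 0 by (simp add: alternating_sum_def)
next
  case (Suc k)
  then have "V \<noteq> {}" by auto
  then obtain c where c: "c \<in> V" "\<And>v. v \<in> V \<Longrightarrow> \<kappa> c \<le> \<kappa> v"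
    using ex_has_least_nat[of "\<lambda>v. v \<in> V" _ \<kappa>] by blast
  then have src: "(u, c) \<notin> S" if "u \<in> V" for u
    using assms(2)[of u c] that by force
  define U where "U = V - {c}"
  have V: "V = insert c U" "c \<notin> U" using c by (auto simp: U_def)
  have U: "finite U" "card U = k" using Suc V by auto
  define Q where "Q = {f \<in> packed_maps V S {}. \<forall>v\<in>V - {c}. f c < f v}"
  define up :: "('v \<Rightarrow> nat) \<Rightarrow> 'v \<Rightarrow> nat" where
    "up f = (\<lambda>v\<in>V. if v = c then 1 else f v + 1)" for f
  define down :: "('v \<Rightarrow> nat) \<Rightarrow> 'v \<Rightarrow> nat" where "down f = (\<lambda>v\<in>U. f v - 1)" for f
  have Q_down: "down f \<in> packed_maps U S {} \<and> up (down f) = f \<and>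
      card (f ` V) = Suc (card (down f ` U))" if "f \<in> Q" for f
  proof (intro conjI)
    from that have fP: "f \<in> packed_maps V S {}" and low: "\<And>v. v \<in> U \<Longrightarrow> f c < f v"
      by (auto simp: Q_def U_def)
    from fP obtain l where f: "f \<in> extensional V" "f ` V = {1..l}"
      "\<And>u v. u \<in> V \<Longrightarrow> v \<in> V \<Longrightarrow> (u, v) \<in> S \<Longrightarrow> f u < f v"
      by (rule packed_mapsE) blast
    have fc: "f c = 1"
    proof -
      have "f c \<in> {1..l}" using f(2) c by blast
      moreover have "1 \<in> f ` V" using calculation f(2) by auto
      ultimately show ?thesis using low V by force
    qed
    have "f ` U = {2..l}"
    proof
      show "f ` U \<subseteq> {2..l}" using f(2) low fc V by force
      show "{2..l} \<subseteq> f ` U"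
      proof
        fix y assume "y \<in> {2..l}"
        then have "y \<in> f ` V" "y \<noteq> f c" using f(2) fc by auto
        then show "y \<in> f ` U" using V by auto
      qed
    qed
    also have "\<dots> = Suc ` {1..l - 1}"
      by (cases l) (auto simp: image_Suc_atLeastAtMost numeral_2_eq_2)
    finally have "(\<lambda>x. x - 1) ` f ` U = {1..l - 1}" by (simp only: image_image) simp
    then have im: "down f ` U = {1..l - 1}" by (simp add: down_def image_image)
    \<comment> \<open>The truncated \<open>l - 1\<close> is one less than \<open>l\<close> only if
      \<open>l\<close> is positive.\<close>
    have "1 \<in> f ` V" using fc c(1) by force
    then have "l \<ge> 1" using f(2) by simp
    then show "card (f ` V) = Suc (card (down f ` U))" unfolding im f(2) by simp
    show "up (down f) = f"
      using f(1) low fc V by (force simp: fun_eq_iff up_def down_def extensional_def)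
    have "down f u < down f v" if "u \<in> U" "v \<in> U" "(u, v) \<in> S" for u v
      using low[OF that(1)] low[OF that(2)] f(3)[of u v] that V by (auto simp: down_def)
    then show "down f \<in> packed_maps U S {}"
      using im unfolding packed_maps_def by (auto simp: down_def)
  qed
  have up_Q: "up f \<in> Q \<and> down (up f) = f" if "f \<in> packed_maps U S {}" for f
  proof
    from that obtain l where f: "f \<in> extensional U" "f ` U = {1..l}"
      "\<And>u v. u \<in> U \<Longrightarrow> v \<in> U \<Longrightarrow> (u, v) \<in> S \<Longrightarrow> f u < f v"
      by (rule packed_mapsE) blast
    show "down (up f) = f"
      using f(1) V by (auto simp: fun_eq_iff up_def down_def extensional_def)
    have pos: "0 < f v" if "v \<in> U" for v using f(2) that by force
    have "up f ` V = insert 1 (Suc ` f ` U)"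
      using V by (force simp: up_def image_iff)
    also have "\<dots> = {1..Suc l}"
      unfolding f(2) image_Suc_atLeastAtMost by auto
    finally have im: "up f ` V = {1..Suc l}" .
    have "up f u < up f v" if "u \<in> V" "v \<in> V" "(u, v) \<in> S" for u v
      using f(3)[of u v] pos[of v] src[of u] that V by (auto simp: up_def)
    then show "up f \<in> Q"
      unfolding Q_def packed_maps_def using im pos V src by (auto simp: up_def)
  qed
  have "alternating_sum V (packed_maps V S {}) = alternating_sum V Q"
    unfolding Q_def using Suc.prems c(1) src by (intro alternating_sum_bottom) auto
  also have "\<dots> = (\<Sum>f\<in>packed_maps U S {}. - ((- 1) ^ card (f ` U)))"
    unfolding alternating_sum_def
    by (rule sum.reindex_bij_witness[of Q up down]) (use Q_down up_Q in auto)
  also have "\<dots> = - alternating_sum U (packed_maps U S {})"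
    by (simp add: alternating_sum_def sum_negf)
  also have "\<dots> = (- 1) ^ card V"
    using Suc.hyps(1)[of U] Suc.hyps(2)[symmetric] U by simp
  finally show ?case .
qed

section \<open>Coefficient extraction by the pairing with \<open>e\<^sub>n\<close>\<close>

text \<open>These are the monomials of the compositions of \<open>n\<close>, the multiplicity of
  \<open>i\<close> being the \<open>i\<close>-th part.\<close>

definition packed_msets :: "nat \<Rightarrow> nat multiset set" where
  "packed_msets n = {m. size m = n \<and> (\<exists>l. set_mset m = {1..l})}"

text \<open>On symmetric functions this is \<open>(-1)^n\<close> times the pairing with
  \<open>e_n\<close>: pairing with \<open>h_\<alpha>\<close> reads off the coefficient of the
  monomial with exponents \<alpha>, and \<open>card (set_mset m)\<close> is the number of
  parts.\<close>

definition packed_functional :: "nat \<Rightarrow> pseries \<Rightarrow> rat" where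
  "packed_functional n F = (\<Sum>m\<in>packed_msets n. (- 1) ^ card (set_mset m) * F m)"

lemma finite_packed_msets: "finite (packed_msets n)"
proof (rule finite_subset)
  show "packed_msets n \<subseteq> mset ` {xs. set xs \<subseteq> {1..n} \<and> length xs = n}"
  proof
    fix m assume "m \<in> packed_msets n"
    then obtain l where m: "size m = n" "set_mset m = {1..l}" by (auto simp: packed_msets_def)
    obtain xs where xs: "m = mset xs" by (metis ex_mset)
    have "l \<le> n" using card_length[of xs] m xs by simp
    then have "set xs \<subseteq> {1..n}" using m xs by auto
    then show "m \<in> mset ` {xs. set xs \<subseteq> {1..n} \<and> length xs = n}"
      using m xs by auto
  qed
  show "finite (mset ` {xs. set xs \<subseteq> {1..n} \<and> length xs = n})"
    by (intro finite_imageI finite_lists_length_eq) simp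
qed

text \<open>Linearity, in the form in which \<open>schur_expansion\<close> provides its
  sums.\<close>

lemma packed_functional_sum:
  "packed_functional n (\<lambda>m. \<Sum>b\<in>B. r b * b m) = (\<Sum>b\<in>B. r b * packed_functional n b)"
  unfolding packed_functional_def sum_distrib_left
  by (subst sum.swap) (simp add: algebra_simps)

text \<open>Serves colorings and tableaux alike, since both kinds of coefficients count fillings by
  content. Grouping the packed fillings by content turns the sum over monomials into one over
  fillings; a wrong degree contributes nothing.\<close>

lemma packed_functional_card:
  assumes "finite V" "F \<subseteq> extensional V"
  shows "packed_functional n (\<lambda>m. of_nat (card {f \<in> F. image_mset f (mset_set V) = m})) =
    (if card V = n then alternating_sum V {f \<in> F. \<exists>l. f ` V = {1..l}} else 0)"
proof -
  define P where "P = {f \<in> F. \<exists>l. f ` V = {1..l}}"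
  define im where "im f = image_mset f (mset_set V)" for f :: "'a \<Rightarrow> nat"
  have set_im: "set_mset (im f) = f ` V" and size_im: "size (im f) = card V" for f
    using assms(1) by (simp_all add: im_def)
  have "P \<subseteq> packed_maps V {} {}"
    using assms(2) by (auto simp: P_def packed_maps_def)
  then have finP: "finite P"
    using finite_packed_maps[OF assms(1)] by (rule finite_subset)
  show ?thesis
  proof (cases "card V = n")
    case False
    then have empty: "{f \<in> F. im f = m} = {}" if "m \<in> packed_msets n" for m
      using that size_im by (auto simp: packed_msets_def)
    have "packed_functional n (\<lambda>m. of_nat (card {f \<in> F. im f = m})) = 0"
      unfolding packed_functional_def by (rule sum.neutral) (simp del: Collect_empty_eq add: empty)
    then show ?thesis using False by (simp add: im_def)
  next
    case True
    have "(- 1) ^ card (set_mset m) * of_nat (card {f \<in> F. im f = m}) =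
        (\<Sum>f\<in>{f \<in> P. im f = m}. (- 1 :: rat) ^ card (f ` V))" if "m \<in> packed_msets n" for m
    proof -
      have "{f \<in> F. im f = m} = {f \<in> P. im f = m}"
        using that set_im by (force simp: packed_msets_def P_def)
      moreover have "(\<Sum>f\<in>{f \<in> P. im f = m}. (- 1 :: rat) ^ card (f ` V)) =
          (\<Sum>f\<in>{f \<in> P. im f = m}. (- 1) ^ card (set_mset m))"
        by (rule sum.cong) (auto simp: set_im)
      ultimately show ?thesis by simp
    qed
    then have "packed_functional n (\<lambda>m. of_nat (card {f \<in> F. im f = m})) =
        (\<Sum>m\<in>packed_msets n. \<Sum>f\<in>{f \<in> P. im f = m}. (- 1) ^ card (f ` V))"
      unfolding packed_functional_def by (rule sum.cong[OF refl])
    also have "\<dots> = (\<Sum>f\<in>P. (- 1) ^ card (f ` V))"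
      using finP finite_packed_msets
      by (rule sum.group) (use set_im size_im True in \<open>auto simp: packed_msets_def P_def\<close>)
    finally show ?thesis using True by (simp add: im_def P_def alternating_sum_def)
  qed
qed

section \<open>Young diagrams, and the vanishing of the functional on Schur functions\<close>

lemma finite_cells: "finite (cells lam)"
  by (simp add: cells_def)

lemma card_cells: "card (cells lam) = sum_list lam"
  by (simp add: cells_def sum_list_sum_nth atLeast0LessThan)

lemma partition_nth_antimono: "partition lam \<Longrightarrow> i \<le> j \<Longrightarrow> j < length lam \<Longrightarrow> lam ! j \<le> lam ! i"
  by (cases "i = j") (auto simp: partition_def sorted_wrt_iff_nth_less)

text \<open>Rows are nonempty and weakly decreasing in length, so a first row of length 1 forces a
  single column, whose length is then \<open>n\<close>.\<close>

lemma partition_row_0: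
  assumes "partition lam" "sum_list lam = n" "lam \<noteq> replicate n 1"
  shows "lam \<noteq> []" "2 \<le> lam ! 0"
proof -
  show "lam \<noteq> []" using assms(2,3) by auto
  show "2 \<le> lam ! 0"
  proof (rule ccontr)
    assume "\<not> 2 \<le> lam ! 0"
    then have "lam ! i = 1" if "i < length lam" for i
    proof -
      have "lam ! i \<le> lam ! 0" using partition_nth_antimono[OF assms(1)] that by simp
      moreover have "lam ! i \<noteq> 0" using assms(1) nth_mem[OF that] by (metis partition_def)
      ultimately show ?thesis using \<open>\<not> 2 \<le> lam ! 0\<close> by linarith
    qed
    then obtain k where "lam = replicate k 1"
      by (metis in_set_conv_nth replicate_eqI)
    then show False using assms(2,3) by (simp add: sum_list_replicate)
  qed
qed

lemma cells_left: "(i, Suc j) \<in> cells lam \<Longrightarrow> (i, j) \<in> cells lam"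
  by (auto simp: cells_def)

lemma cells_above: "partition lam \<Longrightarrow> (Suc i, j) \<in> cells lam \<Longrightarrow> (i, j) \<in> cells lam"
  using partition_nth_antimono[of lam i "Suc i"] by (auto simp: cells_def)

text \<open>Columns give the strict constraints and rows the weak ones. The tableau conditions name
  only the right or lower cell; its neighbour is a cell as well by the shape of the diagram.\<close>

lemma ssyt_packed:
  assumes "partition lam"
  shows "{T \<in> ssyt lam. \<exists>l. T ` cells lam = {1..l}} =
    packed_maps (cells lam) {((i, j), (Suc i, j)) | i j. True} {((i, j), (i, Suc j)) | i j. True}"
    (is "?L = packed_maps ?C ?S ?W")
proof (intro equalityI subsetI)
  fix T assume "T \<in> ?L"
  then show "T \<in> packed_maps ?C ?S ?W"
    by (auto simp: ssyt_def packed_maps_def PiE_def)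
next
  fix T assume "T \<in> packed_maps ?C ?S ?W"
  then obtain l where T: "T \<in> extensional ?C" "T ` ?C = {1..l}"
    "\<And>u v. u \<in> ?C \<Longrightarrow> v \<in> ?C \<Longrightarrow> (u, v) \<in> ?S \<Longrightarrow> T u < T v"
    "\<And>u v. u \<in> ?C \<Longrightarrow> v \<in> ?C \<Longrightarrow> (u, v) \<in> ?W \<Longrightarrow> T u \<le> T v"
    by (rule packed_mapsE) blast
  have "T (i, j) \<le> T (i, Suc j)" if "(i, Suc j) \<in> ?C" for i j
    using that cells_left[OF that] by (intro T(4)) auto
  moreover have "T (i, j) < T (Suc i, j)" if "(Suc i, j) \<in> ?C" for i j
    using that cells_above[OF assms that] by (intro T(3)) auto
  moreover have "T \<in> ?C \<rightarrow>\<^sub>E {1..}"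
    using T(1,2) by (auto simp: PiE_def)
  ultimately have "T \<in> ssyt lam" by (simp add: ssyt_def)
  then show "T \<in> ?L" using T(2) by blast
qed

text \<open>
  The involution is applied to the last cell of the first row; as that row has another cell to
  its left, the last cell is never alone on the lowest level.
\<close>

lemma packed_functional_schur:
  assumes "partition lam" "lam \<noteq> replicate n 1"
  shows "packed_functional n (schur lam) = 0"
proof -
  let ?S = "{((i, j), (Suc i, j)) | i j. True} :: ((nat \<times> nat) \<times> (nat \<times> nat)) set"
  let ?W = "{((i, j), (i, Suc j)) | i j. True} :: ((nat \<times> nat) \<times> (nat \<times> nat)) set"
  have "packed_functional n (schur lam) = (if card (cells lam) = n
      then alternating_sum (cells lam) {T \<in> ssyt lam. \<exists>l. T ` cells lam = {1..l}} else 0)"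
    unfolding schur_def by (rule packed_functional_card) (auto simp: finite_cells ssyt_def PiE_def)
  also have "\<dots> = 0"
  proof (cases "card (cells lam) = n")
    case True
    note row = partition_row_0[OF assms(1) True[unfolded card_cells] assms(2)]
    define c where "c = (0 :: nat, lam ! 0 - 1)"
    define d where "d = (0 :: nat, lam ! 0 - 2)"
    have cd: "c \<in> cells lam" "d \<in> cells lam" "d \<noteq> c" "(d, c) \<in> ?W"
      using row by (auto simp: c_def d_def cells_def)
    have "alternating_sum (cells lam) (packed_maps (cells lam) ?S ?W) =
        alternating_sum (cells lam)
          {f \<in> packed_maps (cells lam) ?S ?W. \<forall>v\<in>cells lam - {c}. f c < f v}"
      by (rule alternating_sum_bottom) (use cd in \<open>auto simp: finite_cells c_def cells_def\<close>)
    also have "{f \<in> packed_maps (cells lam) ?S ?W. \<forall>v\<in>cells lam - {c}. f c < f v} = {}"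
    proof -
      have "f d \<le> f c" if "f \<in> packed_maps (cells lam) ?S ?W" for f
        using that by (rule packed_mapsE) (use cd in blast)
      then show ?thesis using cd(2,3) by (auto simp: not_less dest!: bspec)
    qed
    finally show ?thesis using ssyt_packed[OF assms(1)] by (simp add: alternating_sum_def)
  qed simp
  finally show ?thesis .
qed

text \<open>Orient each edge toward its larger color. The packed colorings that induce a given
  orientation are the packed maps increasing along it; by \<open>alternating_sum_strict\<close>
  every such class contributes the same sign, so nothing cancels.\<close>

lemma packed_functional_chromatic_sym:
  assumes "pair_graph G"
  shows "packed_functional (card (pverts G)) (chromatic_sym G) \<noteq> 0"
proof -
  interpret pair_graph G by fact
  let ?V = "pverts G"
  define P where "P = {\<kappa> \<in> proper_colorings G. \<exists>l. \<kappa> ` ?V = {1..l}}"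
  define ori where "ori \<kappa> = {(u, v) \<in> parcs G. \<kappa> u < \<kappa> v}" for \<kappa> :: "'a \<Rightarrow> nat"
  have V: "u \<in> ?V" "v \<in> ?V" if "(u, v) \<in> parcs G" for u v
    using arc_fst_in_verts[OF that] arc_snd_in_verts[OF that] by auto
  have sym: "(v, u) \<in> parcs G" if "(u, v) \<in> parcs G" for u v
    using pair_sym_arcs that by (auto simp: symmetric_def dest: symD)
  have P_eq: "P = {\<kappa> \<in> extensional ?V. (\<exists>l. \<kappa> ` ?V = {1..l}) \<and> (\<forall>(u, v) \<in> parcs G. \<kappa> u \<noteq> \<kappa> v)}"
    unfolding P_def proper_colorings_def PiE_def by fastforce
  have finP: "finite P"
    by (rule finite_subset[OF _ finite_packed_maps[of ?V "{}" "{}"]])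
      (auto simp: P_eq packed_maps_def)
  \<comment> \<open>As \<open>\<kappa>\<close> is proper and arcs come in opposite pairs,
    \<open>ori \<kappa>\<close> contains exactly one arc of each edge; increasing along it
    determines the whole orientation.\<close>
  have fib: "{\<kappa>' \<in> P. ori \<kappa>' = ori \<kappa>} = packed_maps ?V (ori \<kappa>) {}" if "\<kappa> \<in> P" for \<kappa>
  proof
    show "{\<kappa>' \<in> P. ori \<kappa>' = ori \<kappa>} \<subseteq> packed_maps ?V (ori \<kappa>) {}"
      by (auto simp: P_eq packed_maps_def ori_def)
    show "packed_maps ?V (ori \<kappa>) {} \<subseteq> {\<kappa>' \<in> P. ori \<kappa>' = ori \<kappa>}"
    proof
      fix \<kappa>' assume \<kappa>': "\<kappa>' \<in> packed_maps ?V (ori \<kappa>) {}"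
      have imp: "\<kappa>' u < \<kappa>' v" if "(u, v) \<in> parcs G" "\<kappa> u < \<kappa> v" for u v
        using \<kappa>' that V[OF that(1)] by (auto simp: packed_maps_def ori_def)
      have ne: "\<kappa> u \<noteq> \<kappa> v" if "(u, v) \<in> parcs G" for u v
        using \<open>\<kappa> \<in> P\<close> that by (auto simp: P_eq)
      have iff: "\<kappa>' u < \<kappa>' v \<longleftrightarrow> \<kappa> u < \<kappa> v" "\<kappa>' u \<noteq> \<kappa>' v" if "(u, v) \<in> parcs G" for u v
        using imp[OF that] imp[OF sym[OF that]] ne[OF that] by (auto simp: neq_iff)
      then have "ori \<kappa>' = ori \<kappa>" by (auto simp: ori_def)
      moreover have "\<kappa>' \<in> P" using \<kappa>' iff by (auto simp: P_eq packed_maps_def)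
      ultimately show "\<kappa>' \<in> {\<kappa>' \<in> P. ori \<kappa>' = ori \<kappa>}" by simp
    qed
  qed
  have "packed_functional (card ?V) (chromatic_sym G) = alternating_sum ?V P"
    unfolding chromatic_sym_def P_def
    by (subst packed_functional_card) (auto simp: proper_colorings_def PiE_def)
  also have "\<dots> = (\<Sum>A\<in>ori ` P. alternating_sum ?V {\<kappa> \<in> P. ori \<kappa> = A})"
    unfolding alternating_sum_def using finP by (rule sum.image_gen)
  also have "\<dots> = (\<Sum>A\<in>ori ` P. (- 1) ^ card ?V)"
  proof (rule sum.cong[OF refl])
    fix A assume "A \<in> ori ` P"
    then obtain \<kappa> where "\<kappa> \<in> P" "A = ori \<kappa>" by auto
    \<comment> \<open>The coloring \<open>\<kappa>\<close> itself witnesses that its orientation is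
      acyclic.\<close>
    then show "alternating_sum ?V {\<kappa> \<in> P. ori \<kappa> = A} = (- 1) ^ card ?V"
      using alternating_sum_strict[of ?V "ori \<kappa>" \<kappa>] fib by (auto simp: ori_def)
  qed
  also have "\<dots> = of_nat (card (ori ` P)) * (- 1) ^ card ?V" by simp
  also have "\<dots> \<noteq> 0"
  proof -
    \<comment> \<open>A coloring with all colors distinct is proper, as there are no loops, so at
      least one orientation occurs.\<close>
    obtain h where h: "bij_betw h ?V {1..card ?V}"
      using finite_same_card_bij[of ?V "{1..card ?V}"] by auto
    then have "restrict h ?V ` ?V = {1..card ?V}" by (simp add: bij_betw_def)
    moreover have "restrict h ?V u \<noteq> restrict h ?V v" if "(u, v) \<in> parcs G" for u v
      using V[OF that] pair_no_loops[OF that] h by (auto simp: bij_betw_def inj_on_def)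
    ultimately have "restrict h ?V \<in> P" unfolding P_eq by blast
    then have "card (ori ` P) \<noteq> 0" using finP by auto
    then show ?thesis by simp
  qed
  finally show ?thesis .
qed

section \<open>Schur functions of columns and complete graphs\<close>

lemma column_strict_sorted:
  assumes "T \<in> ssyt (replicate n 1)"
  shows "sorted_wrt (<) (map (\<lambda>i. T (i, 0)) [0..<n])"
proof -
  have "T (i, 0) < T (Suc i, 0)" if "Suc i < n" for i
    using assms that by (auto simp: ssyt_def cells_def)
  then show ?thesis by (simp add: sorted_wrt_iff_nth_Suc_transp transp_on_def)
qed

lemma cells_column: "cells (replicate n 1) = (\<lambda>i. (i, 0)) ` {..<n}"
  by (auto simp: cells_def)

lemma column_inj:
  assumes "T \<in> ssyt (replicate n 1)"
  shows "inj_on T (cells (replicate n 1))"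
proof -
  have "distinct (map (\<lambda>i. T (i, 0)) [0..<n])"
    using column_strict_sorted[OF assms] strict_sorted_iff by blast
  then have "inj_on (\<lambda>i. T (i, 0)) {..<n}"
    by (simp add: distinct_map lessThan_atLeast0)
  then show ?thesis unfolding cells_column by (auto simp: inj_on_def)
qed

text \<open>Entries of a column increase strictly, so the tableau lists their set in increasing
  order.\<close>

lemma column_exists_unique:
  assumes "finite S" "0 \<notin> S"
  shows "{T \<in> ssyt (replicate (card S) 1).
      image_mset T (mset_set (cells (replicate (card S) 1))) = mset_set S} =
    {\<lambda>x\<in>cells (replicate (card S) 1). sorted_list_of_set S ! fst x}"
    (is "?L = {?T}")
proof
  let ?C = "cells (replicate (card S) 1)" and ?xs = "sorted_list_of_set S"
  have Ti: "?T (i, 0) = ?xs ! i" if "i < card S" for i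
    using that by (simp add: cells_def)
  show "?L \<subseteq> {?T}"
  proof
    fix T assume T: "T \<in> ?L"
    then have inj: "inj_on T ?C" using column_inj by blast
    have "mset_set (T ` ?C) = mset_set S"
      using T image_mset_mset_set[OF inj] by simp
    then have "T ` ?C = S" using assms(1) finite_cells by (metis finite_imageI finite_set_mset_mset_set)
    then have "set (map (\<lambda>i. T (i, 0)) [0..<card S]) = S"
      unfolding cells_column image_image by (simp add: lessThan_atLeast0)
    then have eq: "map (\<lambda>i. T (i, 0)) [0..<card S] = ?xs"
      using column_strict_sorted[of T "card S"] T assms(1)
      by (intro strict_sorted_equal) auto
    have "T (i, 0) = ?xs ! i" if "i < card S" for i
      using that unfolding eq[symmetric] by simp
    moreover have "T \<in> extensional ?C" using T by (auto simp: ssyt_def PiE_def)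
    ultimately have "T = ?T"
      using Ti unfolding cells_column by (intro extensionalityI[of T]) auto
    then show "T \<in> {?T}" by simp
  qed
  have ss: "sorted_wrt (<) ?xs" "length ?xs = card S" "set ?xs = S" using assms(1) by auto
  have pos: "?xs ! i \<ge> 1" if "i < card S" for i
    using that ss(2,3) assms(2) nth_mem[of i ?xs] by (cases "?xs ! i") auto
  have T: "?T \<in> ssyt (replicate (card S) 1)"
    unfolding ssyt_def cells_column using ss(1,2) pos
    by (auto simp: sorted_wrt_iff_nth_less)
  have "?T ` ?C = S"
  proof -
    have "?T ` ?C = (\<lambda>i. ?xs ! i) ` {..<card S}"
      unfolding cells_column image_image by (intro image_cong) auto
    also have "\<dots> = set ?xs" unfolding set_conv_nth using ss(2) by auto
    finally show ?thesis using ss(3) by simp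
  qed
  then show "{?T} \<subseteq> ?L"
    using T image_mset_mset_set[OF column_inj[OF T]] by simp
qed

text \<open>Proper colorings of a complete graph are injective, as are column tableaux, so both
  sides live on squarefree monomials of degree \<open>n\<close>. On each of these there is one
  tableau, and the number \<open>k\<close> of colorings is the same for all.\<close>

lemma chromatic_sym_complete:
  fixes K :: "'a pair_pre_digraph"
  assumes "complete_digraph n (with_proj K)"
  obtains k where "k > 0" "chromatic_sym K = pscale k (schur (replicate n 1))"
proof
  let ?V = "pverts K" and ?C = "cells (replicate n 1)"
  have V: "finite ?V" "card ?V = n"
    and E: "parcs K = {(u, v). (u, v) \<in> ?V \<times> ?V \<and> u \<noteq> v}"
    using assms unfolding complete_digraph_pair_def by auto
  have pc: "proper_colorings K = {\<kappa> \<in> ?V \<rightarrow>\<^sub>E {1..}. inj_on \<kappa> ?V}"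
    unfolding proper_colorings_def E by (auto simp: inj_on_def)
  \<comment> \<open>This is \<open>n!\<close>, in the form in which
    \<open>card_inj_on_subset_funcset\<close> counts injections.\<close>
  define k :: nat where "k = prod ((-) n) {0..<n}"
  have "k > 0" unfolding k_def by (rule prod_pos) simp
  then show "(of_nat k :: rat) > 0" by simp
  show "chromatic_sym K = pscale (of_nat k) (schur (replicate n 1))"
  proof
    fix m
    show "chromatic_sym K m = pscale (of_nat k) (schur (replicate n 1)) m"
    proof (cases "\<exists>S. finite S \<and> card S = n \<and> 0 \<notin> S \<and> m = mset_set S")
      case True
      then obtain S where S: "finite S" "card S = n" "0 \<notin> S" "m = mset_set S" by blast
      have "{\<kappa> \<in> proper_colorings K. image_mset \<kappa> (mset_set ?V) = m} =
          {\<kappa> \<in> ?V \<rightarrow>\<^sub>E S. inj_on \<kappa> ?V}"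
      proof (intro set_eqI iffI)
        fix \<kappa> assume "\<kappa> \<in> {\<kappa> \<in> proper_colorings K. image_mset \<kappa> (mset_set ?V) = m}"
        then have \<kappa>: "\<kappa> \<in> extensional ?V" "inj_on \<kappa> ?V" "image_mset \<kappa> (mset_set ?V) = mset_set S"
          using S(4) unfolding pc by (auto simp: PiE_def)
        then have "\<kappa> ` ?V = S"
          using S(1) V(1) by (metis finite_imageI finite_set_mset_mset_set image_mset_mset_set)
        then show "\<kappa> \<in> {\<kappa> \<in> ?V \<rightarrow>\<^sub>E S. inj_on \<kappa> ?V}" using \<kappa> by (auto simp: PiE_def)
      next
        fix \<kappa> assume "\<kappa> \<in> {\<kappa> \<in> ?V \<rightarrow>\<^sub>E S. inj_on \<kappa> ?V}"
        then have \<kappa>: "\<kappa> \<in> ?V \<rightarrow>\<^sub>E S" "inj_on \<kappa> ?V" by auto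
        have "\<kappa> ` ?V = S"
          using \<kappa> S(1,2) V(2) by (intro card_subset_eq) (auto simp: card_image)
        then have "image_mset \<kappa> (mset_set ?V) = m"
          using image_mset_mset_set[OF \<kappa>(2)] S(4) by simp
        moreover have "S \<subseteq> {1..}" using S(3) by (metis atLeast_iff less_one not_le subsetI)
        then have "\<kappa> \<in> ?V \<rightarrow>\<^sub>E {1..}" using \<kappa>(1) by (auto simp: PiE_def Pi_def)
        ultimately show "\<kappa> \<in> {\<kappa> \<in> proper_colorings K. image_mset \<kappa> (mset_set ?V) = m}"
          using \<kappa>(2) by (simp add: pc)
      qed
      then have "chromatic_sym K m = of_nat k"
        using card_inj_on_subset_funcset[OF V(1) S(1) order_refl] S(2) V(2)
        by (simp add: chromatic_sym_def k_def)
      moreover have "schur (replicate n 1) m = 1"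
        using column_exists_unique[OF S(1,3)] S(2,4) by (auto simp: schur_def card_eq_0_iff)
      ultimately show ?thesis by (simp add: pscale_def)
    next
      case False
      have "image_mset \<kappa> (mset_set ?V) \<noteq> m" if "\<kappa> \<in> proper_colorings K" for \<kappa>
      proof
        assume "image_mset \<kappa> (mset_set ?V) = m"
        then have "m = mset_set (\<kappa> ` ?V)" using that image_mset_mset_set by (auto simp: pc)
        moreover have "0 \<notin> \<kappa> ` ?V" using that by (force simp: pc)
        moreover have "card (\<kappa> ` ?V) = n" using that V by (simp add: pc card_image)
        ultimately show False using False V(1) by blast
      qed
      then have "chromatic_sym K m = 0" by (auto simp: chromatic_sym_def card_eq_0_iff)
      moreover have "image_mset T (mset_set ?C) \<noteq> m" if "T \<in> ssyt (replicate n 1)" for T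
      proof
        assume "image_mset T (mset_set ?C) = m"
        then have "m = mset_set (T ` ?C)"
          using image_mset_mset_set[OF column_inj[OF that]] by simp
        moreover have "0 \<notin> T ` ?C"
        proof
          assume "0 \<in> T ` ?C"
          then obtain x where "x \<in> ?C" "T x = 0" by auto
          then show False using that PiE_mem[of T ?C "\<lambda>_. {1..}" x] by (simp add: ssyt_def)
        qed
        moreover have "card (T ` ?C) = n"
          using column_inj[OF that] by (simp add: card_image card_cells sum_list_replicate)
        ultimately show False using False finite_cells by blast
      qed
      then have "schur (replicate n 1) m = 0" by (auto simp: schur_def card_eq_0_iff)
      ultimately show ?thesis by (simp add: pscale_def)
    qed
  qed
qed

text \<open>An infinite set has \<open>card\<close> 0, so finiteness is what lets a single tableau
  make a Schur coefficient positive.\<close>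

lemma finite_fillings:
  assumes "finite V" "F \<subseteq> extensional V"
  shows "finite {f \<in> F. image_mset f (mset_set V) = m}"
proof (rule finite_subset)
  show "{f \<in> F. image_mset f (mset_set V) = m} \<subseteq> V \<rightarrow>\<^sub>E set_mset m"
    using assms by (auto simp: PiE_def)
  show "finite (V \<rightarrow>\<^sub>E set_mset m)" using assms(1) by (rule finite_PiE) simp
qed

text \<open>The monomial is \<open>x\<^sup>\<lambda>\<close>, realized by the tableau with constant rows \<open>1, 2, \<dots>\<close>.\<close>

lemma schur_dominant_monomial:
  assumes "partition lam" "lam \<noteq> replicate n 1"
  obtains m where "schur lam m > 0" "schur (replicate n 1) m = 0"
proof
  let ?C = "cells lam" and ?D = "cells (replicate n 1)"
  define T where "T = (\<lambda>x\<in>cells lam. Suc (fst x))"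
  define m where "m = image_mset T (mset_set ?C)"
  have T: "T \<in> ssyt lam"
    unfolding ssyt_def T_def by (auto dest: cells_left cells_above[OF assms(1)])
  have "finite {U \<in> ssyt lam. image_mset U (mset_set ?C) = m}"
    by (rule finite_fillings) (auto simp: finite_cells ssyt_def PiE_def)
  moreover have "T \<in> {U \<in> ssyt lam. image_mset U (mset_set ?C) = m}"
    using T by (simp add: m_def)
  ultimately show "schur lam m > 0" unfolding schur_def by (auto simp: card_gt_0_iff)
  \<comment> \<open>A column has distinct entries, so equal content would make \<open>T\<close>
    injective, but \<open>T\<close> repeats 1 in its first row.\<close>
  have "image_mset U (mset_set ?D) \<noteq> m" if "U \<in> ssyt (replicate n 1)" for U
  proof
    assume eq: "image_mset U (mset_set ?D) = m"
    have size: "card ?C = n"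
      using arg_cong[OF eq, of size] by (simp add: m_def card_cells sum_list_replicate)
    note row = partition_row_0[OF assms(1) size[unfolded card_cells] assms(2)]
    have "T ` ?C = U ` ?D"
      using arg_cong[OF eq, of set_mset] by (simp add: m_def finite_cells)
    then have "card (T ` ?C) = card ?C"
      using column_inj[OF that] size by (simp add: card_image card_cells sum_list_replicate)
    then have "inj_on T ?C" using finite_cells by (metis eq_card_imp_inj_on)
    moreover have "(0, 0) \<in> ?C" "(0, 1) \<in> ?C" using row by (auto simp: cells_def)
    ultimately show False unfolding inj_on_def by (force simp: T_def)
  qed
  then show "schur (replicate n 1) m = 0" by (auto simp: schur_def card_eq_0_iff)
qed

section \<open>Comparison with the complete graph\<close>

abbreviation schur_functions :: "pseries set" where
  "schur_functions \<equiv> schur ` {mu. partition mu}"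

lemma schur_expansion:
  assumes "pseries.independent schur_functions" "F \<in> pseries.span schur_functions"
  defines "r \<equiv> pseries.representation schur_functions F"
  shows "F = (\<lambda>m. \<Sum>b | r b \<noteq> 0. r b * b m)"
proof
  fix m
  have sum_apply: "(\<Sum>b\<in>B. pscale (r b) b) m = (\<Sum>b\<in>B. r b * b m)" for B :: "pseries set"
    by (induction B rule: infinite_finite_induct) (auto simp: pscale_def)
  have "(\<Sum>b | r b \<noteq> 0. pscale (r b) b) = F"
    unfolding r_def using assms(1,2) by (rule pseries.sum_nonzero_representation_eq)
  then show "F m = (\<Sum>b | r b \<noteq> 0. r b * b m)"
    using sum_apply[of "{b. r b \<noteq> 0}"] by simp
qed

lemma partition_replicate_1: "partition (replicate n 1)"
  by (simp add: partition_def sorted_wrt_iff_nth_less)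

text \<open>Apply \<open>packed_functional\<close> to the Schur expansion: it kills every term but
  the column. If that coefficient vanished too, the functional would be 0 on the chromatic symmetric
  function.\<close>

lemma schur_coeff_column_nonzero:
  assumes "pair_graph G" "pseries.independent schur_functions"
    "chromatic_sym G \<in> pseries.span schur_functions"
  shows "schur_coeff (replicate (card (pverts G)) 1) (chromatic_sym G) \<noteq> 0"
proof
  let ?n = "card (pverts G)"
  define r where "r = pseries.representation schur_functions (chromatic_sym G)"
  assume "schur_coeff (replicate ?n 1) (chromatic_sym G) = 0"
  then have r0: "r (schur (replicate ?n 1)) = 0" by (simp add: schur_coeff_def r_def)
  have "packed_functional ?n b = 0" if "r b \<noteq> 0" for b
  proof -
    have "b \<in> schur_functions"
      using that unfolding r_def by (rule pseries.representation_ne_zero)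
    then obtain lam where "b = schur lam" "partition lam" by blast
    then show ?thesis using that r0 by (auto intro!: packed_functional_schur)
  qed
  then have "(\<Sum>b | r b \<noteq> 0. r b * packed_functional ?n b) = 0" by simp
  moreover have "packed_functional ?n (chromatic_sym G) =
      packed_functional ?n (\<lambda>m. \<Sum>b | r b \<noteq> 0. r b * b m)"
    by (rule arg_cong[OF schur_expansion[OF assms(2,3), folded r_def]])
  ultimately have "packed_functional ?n (chromatic_sym G) = 0"
    by (simp only: packed_functional_sum)
  then show False using packed_functional_chromatic_sym[OF assms(1)] by simp
qed

lemma schur_coeff_outside_span:
  assumes "\<not> (pseries.independent schur_functions \<and> F \<in> pseries.span schur_functions)"
  shows "schur_coeff lam F = 0"
  using assms by (auto simp: schur_coeff_def pseries.representation_def)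

text \<open>
  Linear independence and spanning need not be established: if either fails, then all
  coefficients of \<open>X\<^sub>G\<close> take the junk value 0 of \<^const>\<open>module.representation\<close>, so \<^term>\<open>X_s n G K\<close> is \<open>X\<^sub>G\<close>,
  which counts as Schur-positive.
\<close>

lemma schur_positive_X_s_swap:
  assumes G: "pair_graph G" "card (pverts G) = n"
    and K: "chromatic_sym K = pscale k (schur (replicate n 1))" "k > 0"
    and pos: "schur_positive (X_s n K G)"
  shows "schur_positive (X_s n G K)"
proof (cases "pseries.independent schur_functions \<and> chromatic_sym G \<in> pseries.span schur_functions")
  case False
  then have zero: "schur_coeff mu (chromatic_sym G) = 0" for mu
    by (rule schur_coeff_outside_span)
  then have "X_s n G K = chromatic_sym G" by (simp add: X_s_def)
  then show ?thesis using zero by (simp add: schur_positive_def)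
next
  case True
  then have ind: "pseries.independent schur_functions"
    and span: "chromatic_sym G \<in> pseries.span schur_functions" by auto
  define e where "e = schur (replicate n 1)"
  define r where "r = pseries.representation schur_functions (chromatic_sym G)"
  define c where "c = r e"
  have e: "e \<in> schur_functions" using partition_replicate_1 by (auto simp: e_def)
  have K_span: "chromatic_sym K \<in> pseries.span schur_functions"
    using e K(1) by (simp add: e_def pseries.span_base pseries.span_scale)
  have rK: "pseries.representation schur_functions (chromatic_sym K) = (\<lambda>b. k * (if b = e then 1 else 0))"
    unfolding K(1) e_def[symmetric] using ind e
    by (subst pseries.representation_scale) (auto simp: pseries.representation_basis pseries.span_base)
  have coeff: "schur_coeff mu (chromatic_sym G - pscale a (chromatic_sym K)) =
      r (schur mu) - a * (k * (if schur mu = e then 1 else 0))"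
    and coeff': "schur_coeff mu (chromatic_sym K - pscale a (chromatic_sym G)) =
      k * (if schur mu = e then 1 else 0) - a * r (schur mu)" for mu a
    using ind span K_span
    by (simp_all add: schur_coeff_def r_def rK pseries.representation_diff
        pseries.representation_scale pseries.span_scale)
  have c0: "c \<noteq> 0"
    using schur_coeff_column_nonzero[OF G(1) ind span] G(2)
    by (simp add: schur_coeff_def c_def r_def e_def)
  have ce: "schur_coeff (replicate n 1) (chromatic_sym G) = c"
    "schur_coeff (replicate n 1) (chromatic_sym K) = k"
    using rK by (simp_all add: schur_coeff_def c_def r_def e_def)
  define q where "q = k / c"
  \<comment> \<open>Away from \<open>e\<close> only the second summand of \<open>X_s n K G\<close>
    contributes, with coefficient \<open>- q * r (schur mu)\<close>.\<close>
  have sign: "q * r (schur mu) \<le> 0" if "partition mu" "schur mu \<noteq> e" for mu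
    using pos that unfolding schur_positive_def X_s_def ce coeff' q_def by force
  have nonneg: "r (schur mu) \<ge> 0" if mu: "partition mu" "schur mu \<noteq> e" for mu
  proof (cases "c < 0")
    case True
    then have "q < 0" using K(2) by (simp add: q_def divide_pos_neg)
    then show ?thesis using sign[OF mu] by (simp add: mult_le_0_iff)
  next
    case False
    then have "q > 0" using K(2) c0 by (simp add: q_def)
    then have le: "r b \<le> 0" if "r b \<noteq> 0" "b \<noteq> e" for b
    proof -
      have "b \<in> schur_functions"
        using that(1) unfolding r_def by (rule pseries.representation_ne_zero)
      then show ?thesis using sign that(2) \<open>q > 0\<close> by (auto simp: mult_le_0_iff)
    qed
    show ?thesis
    proof (rule ccontr)
      assume neg: "\<not> r (schur mu) \<ge> 0"
      \<comment> \<open>The monomial \<open>m\<close> is absent from \<open>e\<close>, the only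
        basis element with a positive coefficient here. All terms at \<open>m\<close> are thus at
        most 0 and that of \<open>schur mu\<close> is negative, whereas the total counts
        colorings.\<close>
      obtain m where m: "schur mu m > 0" "e m = 0"
        using schur_dominant_monomial[of mu n] mu unfolding e_def by metis
      have "chromatic_sym G m = (\<Sum>b | r b \<noteq> 0. r b * b m)"
        by (rule fun_cong[OF schur_expansion[OF ind span, folded r_def]])
      also have "\<dots> < (\<Sum>b | r b \<noteq> 0. 0)"
      proof (rule sum_strict_mono_ex1)
        show "finite {b. r b \<noteq> 0}"
          unfolding r_def by (rule pseries.finite_representation)
        show "\<forall>b\<in>{b. r b \<noteq> 0}. r b * b m \<le> 0"
        proof
          fix b assume b: "b \<in> {b. r b \<noteq> 0}"
          then have "b \<in> schur_functions"
            unfolding r_def by (auto dest: pseries.representation_ne_zero)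
          then have "b m \<ge> 0" by (auto simp: schur_def)
          then show "r b * b m \<le> 0"
            using le[of b] b m(2) by (cases "b = e") (auto simp: mult_nonpos_nonneg)
        qed
        show "\<exists>b\<in>{b. r b \<noteq> 0}. r b * b m < 0"
          using neg m(1) by (intro bexI[of _ "schur mu"]) (auto simp: mult_neg_pos)
      qed
      finally show False by (simp add: chromatic_sym_def)
    qed
  qed
  \<comment> \<open>At \<open>e\<close> the coefficient is \<open>c - (c / k) * k = 0\<close>;
    elsewhere it is \<open>r (schur mu)\<close>.\<close>
  show ?thesis
    unfolding schur_positive_def X_s_def ce coeff
    using nonneg K(2) by (auto simp: c_def)
qed

text \<open>Connectedness includes having a vertex, which is where \<open>n \<ge> 1\<close>
  enters.\<close>

lemma complete_in_conn_graphs: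
  assumes "n \<ge> 1" "complete_digraph n (with_proj K)"
  shows "K \<in> conn_graphs n"
proof -
  have "pair_graph K" using assms(2) by (rule pair_graphI_complete)
  then interpret pair_graph K .
  have K: "card (pverts K) = n" "parcs K = {(u, v). (u, v) \<in> pverts K \<times> pverts K \<and> u \<noteq> v}"
    using assms(2) unfolding complete_digraph_pair_def by auto
  have "connected (with_proj K)"
  proof (rule connectedI)
    show "pverts K \<noteq> {}" using K(1) assms(1) by auto
  next
    fix u v assume uv: "u \<in> pverts K" "v \<in> pverts K"
    have "u \<rightarrow>\<^sup>*\<^bsub>with_proj K\<^esub> v"
    proof (cases "u = v")
      case True
      then show ?thesis using uv by (simp add: reachable_refl)
    next
      case False
      then have "(u, v) \<in> parcs K" using uv K(2) by simp
      then show ?thesis by (rule reachable_adjI)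
    qed
    then show "u \<rightarrow>\<^sup>*\<^bsub>mk_symmetric (with_proj K)\<^esub> v"
      by (rule reachable_mk_symmetricI)
  qed
  then show ?thesis using K(1) \<open>pair_graph K\<close> by (simp add: conn_graphs_def)
qed

theorem corollary4p5:
  fixes n :: nat and K :: "'a pair_pre_digraph"
  assumes "n \<ge> 1"
    and "complete_digraph n (with_proj K)"
  shows "minimal_elem (S_poset n) (ge_s n) (same_csf n `` {K})"
proof -
  have K: "K \<in> conn_graphs n" using assms by (rule complete_in_conn_graphs)
  obtain k where k: "k > 0" "chromatic_sym K = pscale k (schur (replicate n 1))"
    using assms(2) by (rule chromatic_sym_complete)
  have "ge_s n Y (same_csf n `` {K})"
    if Y: "Y \<in> S_poset n" "ge_s n (same_csf n `` {K}) Y" for Y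
  proof -
    \<comment> \<open>The representative \<open>K'\<close> may differ from \<open>K\<close> but has
      the same chromatic symmetric function; the same pair then witnesses the reverse
      comparison.\<close>
    obtain K' G where K': "K' \<in> same_csf n `` {K}" and "G \<in> Y" and pos: "schur_positive (X_s n K' G)"
      using Y(2) unfolding ge_s_def by blast
    have "pair_graph G" "card (pverts G) = n"
      using Y(1) \<open>G \<in> Y\<close> by (auto simp: S_poset_def quotient_def same_csf_def conn_graphs_def)
    moreover have "chromatic_sym K' = pscale k (schur (replicate n 1))"
      using K' k(2) by (auto simp: same_csf_def)
    ultimately have "schur_positive (X_s n G K')"
      using k(1) pos by (rule schur_positive_X_s_swap)
    then show ?thesis using K' \<open>G \<in> Y\<close> unfolding ge_s_def by blast
  qed
  moreover have "same_csf n `` {K} \<in> S_poset n"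
    unfolding S_poset_def using K by (rule quotientI)
  ultimately show ?thesis unfolding minimal_elem_def by blast
qed

end
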